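(* Let $\mathcal{L}_X$ and $\mathcal{L}_Y$ be laminations of spaces $X\subset\mathbb{R}^n$ and $Y\subset\mathbb{R}^n$, respectively, where $n\ge2$. Suppose $f: \mathcal{E}(\mathcal{L}_X) \to \mathcal{E}(\mathcal{L}_Y)$ is a continuous function which maps the endpoints of any arc in $\mathcal{L}_X$ onto the set of endpoints of some arc in $\mathcal{L}_Y$. Then there exists a continuous extension $F: X \to Y$ of $f$ which is one-to-one on each arc in $\mathcal{L}_X$. Moreover, if additionally $f$ is a homeomorphism and $f^{-1}$ maps the endpoints of any arc in $\mathcal{L}_Y$ to the endpoints of some arc in $\mathcal{L}_X$, then $F$ is a homeomorphism.
   Context: An arc is a space homeomorphic to $[0,1]$. A collection of arcs $\mathcal{L}_X$ is a lamination of a space $X\subset\mathbb{R}^n$ if: (1) $X=\bigcup\mathcal{L}_X$; (2) any two distinct arcs in $\mathcal{L}_X$ meet at most in one common endpoint; (3) given a sequence $\langle A_i\rangle_{i=1}^\infty$ of arcs in $\mathcal{L}_X$: (a) if $\mathrm{diam}\,A_i\to0$, then any accumulation point of the arcs $A_i$ (a point each of whose neighborhoods meets $A_i$ for infinitely many $i$) is either an endpoint of some arc in $\mathcal{L}_X$, or not in $X$; (b) otherwise, there is an arc $A_\infty\in\mathcal{L}_X$, a subsequence $\langle A_{i_j}\rangle_{j=1}^\infty$ and homeomorphisms $h_j:A_\infty\to A_{i_j}$ such that $d_{\mathrm{sup}}(h_j,\mathrm{id}_{A_\infty})\to0$ as $j\to\infty$, where $d_{\mathrm{sup}}(g,h)=\sup_p|g(p)-h(p)|$.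 $\mathcal{E}(\mathcal{L}_X)$ denotes the set of all endpoints of the arcs in $\mathcal{L}_X$ (a subspace of $X$). *)

theory Defs
  imports "HOL-Analysis.Analysis"
begin

definition is_arc :: "'a::topological_space set \<Rightarrow> bool" where
  "is_arc A \<longleftrightarrow> A homeomorphic {0..1::real}"

(* Every point that is the initial or final point of some injective parametrization of A;
   by invariance of endpoints under homeomorphism, an arc has exactly two of them. *)
definition arc_endpoints :: "'a::topological_space set \<Rightarrow> 'a set" where
  "arc_endpoints A =
     {x. \<exists>g. arc g \<and> path_image g = A \<and> (x = pathstart g \<or> x = pathfinish g)}"

definition endpoint_set :: "'a::topological_space set set \<Rightarrow> 'a set" where
  "endpoint_set L = (\<Union>A\<in>L. arc_endpoints A)"

definition accumulation_point :: "(nat \<Rightarrow> 'a::topological_space set) \<Rightarrow> 'a \<Rightarrow> bool" where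
  "accumulation_point A p \<longleftrightarrow> (\<forall>U. open U \<and> p \<in> U \<longrightarrow> infinite {i. A i \<inter> U \<noteq> {}})"

(* Only applied to maps that are continuous on an arc S, where the supremum is over a
   nonempty bounded set of reals. *)
definition sup_dist :: "'a set \<Rightarrow> ('a \<Rightarrow> 'b::metric_space) \<Rightarrow> ('a \<Rightarrow> 'b) \<Rightarrow> real" where
  "sup_dist S g h = (SUP p\<in>S. dist (g p) (h p))"

definition lamination :: "'a::metric_space set \<Rightarrow> 'a set set \<Rightarrow> bool" where
  "lamination X L \<longleftrightarrow>
     (\<forall>A\<in>L. is_arc A) \<and>
     X = \<Union>L \<and>
     (\<forall>A\<in>L. \<forall>B\<in>L. A \<noteq> B \<longrightarrow>
        A \<inter> B = {} \<or> (\<exists>p \<in> arc_endpoints A \<inter> arc_endpoints B. A \<inter> B = {p})) \<and>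
     (\<forall>A :: nat \<Rightarrow> 'a set. range A \<subseteq> L \<longrightarrow>
        (if (\<lambda>i. diameter (A i)) \<longlonglongrightarrow> 0
         then \<forall>p. accumulation_point A p \<longrightarrow> p \<in> endpoint_set L \<or> p \<notin> X
         else \<exists>A\<^sub>0\<in>L. \<exists>r :: nat \<Rightarrow> nat. \<exists>h :: nat \<Rightarrow> 'a \<Rightarrow> 'a.
                strict_mono r \<and>
                (\<forall>j. \<exists>k. homeomorphism A\<^sub>0 (A (r j)) (h j) k) \<and>
                (\<lambda>j. sup_dist A\<^sub>0 (h j) id) \<longlonglongrightarrow> 0))"

end

theory Submission
  imports Defs
begin

text \<open>
  Every arc with ordered ends \<open>a\<close>, \<open>b\<close> carries a canonical homeomorphism onto \<open>{0..1}\<close>: a Whitney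
  map (a strictly monotone, Hausdorff-Lipschitz size function on sets) measures the subarcs from
  \<open>a\<close> to \<open>x\<close> and from \<open>b\<close> to \<open>x\<close>, and the normalised difference of these sizes is the position
  of \<open>x\<close>. It depends continuously on the arc in the sense of condition (3b), and exchanging \<open>a\<close>
  and \<open>b\<close> turns a position \<open>t\<close> into \<open>1 - t\<close>. The extension sends \<open>x\<close> on the arc with ends \<open>a\<close>,
  \<open>b\<close> to the point of the same position on the arc with ends \<open>f a\<close>, \<open>f b\<close>; the extension of an
  inverse of \<open>f\<close> is then the inverse map. For continuity along \<open>x\<^sub>i \<rightarrow> x\<close>, with \<open>x\<^sub>i\<close> on the arc
  \<open>A\<^sub>i\<close>, one applies condition (3) twice. If the diameters of the \<open>A\<^sub>i\<close> tend to \<open>0\<close>, then \<open>x\<close> is an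
  endpoint, and the image arcs shrink too, since a limit arc would have both ends at \<open>f x\<close>. Otherwise
  a subsequence of the \<open>A\<^sub>i\<close> converges to an arc through \<open>x\<close>; the image arcs cannot shrink because
  \<open>f\<close> separates its two ends, so a further subsequence of them converges as well.
\<close>

subsection \<open>A Whitney map\<close>

text \<open>One dense sequence is chosen per type, so that the same size function measures all arcs
  of a space. An enumeration is used because the terms of the series need weights.\<close>

definition dense_seq :: "nat \<Rightarrow> 'a::second_countable_topology" where
  "dense_seq = (SOME q. \<forall>U. open U \<longrightarrow> U \<noteq> {} \<longrightarrow> (\<exists>n. q n \<in> U))"

lemma dense_seq_dense:
  fixes U :: "'a::second_countable_topology set"
  assumes "open U" "U \<noteq> {}"
  shows "\<exists>n. dense_seq n \<in> U"
proof -
  obtain D :: "'a set" where D: "countable D" "\<And>U. open U \<Longrightarrow> U \<noteq> {} \<Longrightarrow> \<exists>d\<in>D. d \<in> U"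
    using countable_dense_setE by blast
  have "D \<noteq> {}"
    using D(2)[OF open_UNIV] by auto
  have "\<exists>n. from_nat_into D n \<in> V" if V: "open V" "V \<noteq> {}" for V
    using D(2)[OF V] from_nat_into_surj[OF D(1)] by metis
  then have "\<exists>q::nat \<Rightarrow> 'a. \<forall>U. open U \<longrightarrow> U \<noteq> {} \<longrightarrow> (\<exists>n. q n \<in> U)"
    by blast
  from someI_ex[OF this] show ?thesis
    using assms unfolding dense_seq_def by blast
qed

text \<open>The infimum distance shrinks as the set grows, so every term is monotone in the set, and
  strictly so as soon as the dense sequence comes near a new point.\<close>

definition whitney_term :: "'a::{metric_space, second_countable_topology} set \<Rightarrow> nat \<Rightarrow> real" where
  "whitney_term K n = (1/2)^n * (1 - min 1 (infdist (dense_seq n) K))"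

definition whitney :: "'a::{metric_space, second_countable_topology} set \<Rightarrow> real" where
  "whitney K = (\<Sum>n. whitney_term K n)"

lemma summable_whitney_term: "summable (whitney_term K)"
proof (rule summable_comparison_test')
  show "summable (\<lambda>n. (1/2::real)^n)"
    by (simp add: summable_geometric)
  show "norm (whitney_term K n) \<le> (1/2)^n" if "0 \<le> n" for n
    by (auto simp: whitney_term_def abs_mult infdist_nonneg min_def)
qed

lemma whitney_strict_mono:
  assumes "closed K" "K \<noteq> {}" "K \<subset> L"
  shows "whitney K < whitney L"
proof -
  have le: "whitney_term K n \<le> whitney_term L n" for n
    using infdist_mono[of K L "dense_seq n"] assms by (auto simp: whitney_term_def)
  obtain p where p: "p \<in> L" "p \<notin> K"
    using assms by blast
  \<comment> \<open>The terms truncate distances at 1, so \<open>d\<close> is capped at 1: a dense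
    point within \<open>d/3\<close> of \<open>p\<close> then has truncated distance at most
    \<open>d/3\<close> from \<open>L\<close> but more than \<open>d/3\<close> from
    \<open>K\<close>.\<close>
  define d where "d = min 1 (infdist p K)"
  have d: "0 < d" "d \<le> 1" "d \<le> infdist p K"
    using infdist_pos_not_in_closed[OF assms(1,2) p(2)] by (auto simp: d_def)
  have "ball p (d/3) \<noteq> {}"
    using d by simp
  then obtain n where n: "dist p (dense_seq n) < d/3"
    using dense_seq_dense[OF open_ball, of p "d/3"] by auto
  have "infdist (dense_seq n) L \<le> d/3"
    using infdist_le[OF p(1), of "dense_seq n"] n by (simp add: dist_commute)
  moreover have "infdist (dense_seq n) K > d/3"
    using infdist_triangle[of p K "dense_seq n"] n d by linarith
  ultimately have "whitney_term K n < whitney_term L n"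
    using d by (auto simp: whitney_term_def)
  then have "0 < (\<Sum>n. whitney_term L n - whitney_term K n)"
    using le by (intro suminf_pos2[of _ n] summable_diff summable_whitney_term) (auto simp: le)
  then show ?thesis
    by (simp add: whitney_def suminf_diff[OF summable_whitney_term summable_whitney_term, symmetric])
qed

text \<open>One half of a Hausdorff estimate: a nearly closest point of \<open>K\<close> is replaced
  by its neighbour in \<open>L\<close> at a cost of at most \<open>e\<close>.\<close>

lemma infdist_le_infdist_add:
  assumes "K \<noteq> {}" "\<And>x. x \<in> K \<Longrightarrow> \<exists>y\<in>L. dist x y \<le> e"
  shows "infdist p L \<le> infdist p K + e"
proof -
  have "infdist p L - e \<le> dist p x" if x: "x \<in> K" for x
  proof -
    obtain y where "y \<in> L" "dist x y \<le> e"
      using assms(2)[OF x] by blast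
    then show ?thesis
      using infdist_le[of y L p] dist_triangle[of p y x] by linarith
  qed
  then have "infdist p L - e \<le> infdist p K"
    unfolding infdist_notempty[OF assms(1)] by (intro cINF_greatest assms(1))
  then show ?thesis
    by simp
qed

text \<open>The hypotheses bound the Hausdorff distance by \<open>e\<close>. Truncation at 1 does
  not increase differences, so each term changes by at most \<open>e\<close> times its weight; the
  factor 2 is the sum of the weights \<open>(1/2)^n\<close>.\<close>

lemma whitney_Lipschitz:
  assumes "K \<noteq> {}" "L \<noteq> {}"
    and "\<And>x. x \<in> K \<Longrightarrow> \<exists>y\<in>L. dist x y \<le> e" "\<And>y. y \<in> L \<Longrightarrow> \<exists>x\<in>K. dist y x \<le> e"
  shows "\<bar>whitney K - whitney L\<bar> \<le> 2 * e"
proof -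
  let ?d = "\<lambda>n. whitney_term K n - whitney_term L n"
  have bound: "\<bar>?d n\<bar> \<le> e * (1/2)^n" for n
  proof -
    have "\<bar>min 1 (infdist (dense_seq n) L) - min 1 (infdist (dense_seq n) K)\<bar> \<le> e"
      using infdist_le_infdist_add[OF assms(1,3), of "dense_seq n"]
        infdist_le_infdist_add[OF assms(2,4), of "dense_seq n"] by linarith
    moreover have "?d n = (min 1 (infdist (dense_seq n) L) - min 1 (infdist (dense_seq n) K)) * (1/2)^n"
      by (simp add: whitney_term_def algebra_simps)
    ultimately show ?thesis
      by (simp add: abs_mult mult_right_mono)
  qed
  have s: "summable (\<lambda>n. e * (1/2::real)^n)"
    by (simp add: summable_geometric)
  have sa: "summable (\<lambda>n. \<bar>?d n\<bar>)"
    using bound by (intro summable_comparison_test'[OF s]) auto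
  have "\<bar>whitney K - whitney L\<bar> = \<bar>\<Sum>n. ?d n\<bar>"
    by (simp add: whitney_def suminf_diff[OF summable_whitney_term summable_whitney_term])
  also have "\<dots> \<le> (\<Sum>n. \<bar>?d n\<bar>)"
    by (rule summable_rabs[OF sa])
  also have "\<dots> \<le> (\<Sum>n. e * (1/2)^n)"
    by (rule suminf_le[OF bound sa s])
  also have "\<dots> = 2 * e"
    by (simp add: suminf_mult suminf_geometric summable_geometric)
  finally show ?thesis .
qed

subsection \<open>Arcs, their endpoints and subarcs\<close>

text \<open>A description without a parametrization makes the subarc symmetric in its ends and
  natural under homeomorphisms. If one of the two points lies outside \<open>A\<close>, the family
  is empty and the intersection is \<open>UNIV\<close>.\<close>

definition subarc :: "'a::topological_space set \<Rightarrow> 'a \<Rightarrow> 'a \<Rightarrow> 'a set" where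
  "subarc A a x = \<Inter>{C. connected C \<and> C \<subseteq> A \<and> a \<in> C \<and> x \<in> C}"

lemma subarc_commute: "subarc A a x = subarc A x a"
  by (auto simp: subarc_def)

lemma subarc_path_image:
  fixes g :: "real \<Rightarrow> 'a::t2_space"
  assumes "arc g" "0 \<le> s" "s \<le> t" "t \<le> 1"
  shows "subarc (path_image g) (g s) (g t) = g ` {s..t}"
proof -
  obtain k where k: "homeomorphism {0..1} (path_image g) g k"
    using homeomorphism_arc[OF assms(1)] .
  have "connected (g ` {s..t})"
    using k assms by (intro connected_continuous_image)
      (auto simp: homeomorphism_def intro: continuous_on_subset)
  moreover have "g ` {s..t} \<subseteq> path_image g" "g s \<in> g ` {s..t}" "g t \<in> g ` {s..t}"
    using assms by (auto simp: path_image_def)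
  ultimately have 1: "subarc (path_image g) (g s) (g t) \<subseteq> g ` {s..t}"
    by (auto simp: subarc_def)
  have "g ` {s..t} \<subseteq> C" if C: "connected C" "C \<subseteq> path_image g" "g s \<in> C" "g t \<in> C" for C
  proof -
    have "connected (k ` C)"
      using k C by (intro connected_continuous_image)
        (auto simp: homeomorphism_def intro: continuous_on_subset)
    moreover have "k (g s) = s" "k (g t) = t"
      using homeomorphism_apply1[OF k] assms by auto
    then have "s \<in> k ` C" "t \<in> k ` C"
      using C(3,4) by (metis imageI)+
    ultimately have "{s..t} \<subseteq> k ` C"
      using connected_contains_Icc by blast
    then have "g ` {s..t} \<subseteq> g ` k ` C"
      by blast
    also have "g ` k ` C = C"
      using homeomorphism_apply2[OF k] C by force
    finally show ?thesis .
  qed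
  then have "g ` {s..t} \<subseteq> subarc (path_image g) (g s) (g t)"
    by (auto simp: subarc_def)
  with 1 show ?thesis
    by blast
qed

lemma is_arc_iff_path_image:
  fixes A :: "'a::t2_space set"
  shows "is_arc A \<longleftrightarrow> (\<exists>g. arc g \<and> path_image g = A)"
proof
  assume "is_arc A"
  then obtain g k where "homeomorphism {0..1::real} A g k"
    unfolding is_arc_def homeomorphic_def using homeomorphism_sym by blast
  then have "arc g \<and> path_image g = A"
    by (auto simp: arc_def path_def path_image_def homeomorphism_def intro: inj_on_inverseI)
  then show "\<exists>g. arc g \<and> path_image g = A"
    by blast
next
  assume "\<exists>g. arc g \<and> path_image g = A"
  then show "is_arc A"
    unfolding is_arc_def homeomorphic_def using homeomorphism_arc homeomorphism_sym by metis
qed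

text \<open>Deleting an end leaves an arc connected, while deleting an interior point separates the
  two ends. Hence a start under one parametrization cannot be interior under another.\<close>

lemma arc_start_in_ends:
  fixes g g' :: "real \<Rightarrow> 'a::t2_space"
  assumes "arc g" "arc g'" "path_image g = path_image g'"
  shows "g' 0 \<in> {g 0, g 1}"
proof (rule ccontr)
  assume no: "g' 0 \<notin> {g 0, g 1}"
  obtain k where k: "homeomorphism {0..1} (path_image g) g k"
    using homeomorphism_arc[OF assms(1)] .
  have "g' 0 \<in> path_image g"
    using assms(3) by (auto simp: path_image_def)
  then obtain t where t: "0 \<le> t" "t \<le> 1" "g t = g' 0"
    by (auto simp: path_image_def)
  with no have t01: "0 < t" "t < 1"
    by (auto simp: less_le)
  have inj: "inj_on g' {0..1}" and cont: "continuous_on {0..1} g'"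
    using assms(2) by (auto simp: arc_def path_def)
  have "connected (g' ` {0<..1})"
    by (intro connected_continuous_image continuous_on_subset[OF cont]) auto
  moreover have "g' ` {0<..1} = path_image g - {g' 0}"
  proof -
    have "{0<..1} = {0..1::real} - {0}"
      by auto
    then show ?thesis
      using inj_on_image_set_diff[OF inj, of "{0..1}" "{0}"] assms(3) by (simp add: path_image_def)
  qed
  ultimately have "connected (k ` (path_image g - {g t}))"
    using k t by (intro connected_continuous_image)
      (auto simp: homeomorphism_def intro: continuous_on_subset)
  moreover have "0 \<in> k ` (path_image g - {g t})" "1 \<in> k ` (path_image g - {g t})"
    using homeomorphism_apply1[OF k, of 0] homeomorphism_apply1[OF k, of 1] no t
    by (force simp: path_image_def)+
  ultimately have "{0..1} \<subseteq> k ` (path_image g - {g t})"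
    using connected_contains_Icc by blast
  then have "t \<in> k ` (path_image g - {g t})"
    using t by auto
  then show False
    using homeomorphism_apply2[OF k] by auto
qed

lemma arc_endpoints_path_image:
  fixes g :: "real \<Rightarrow> 'a::t2_space"
  assumes "arc g"
  shows "arc_endpoints (path_image g) = {g 0, g 1}"
proof -
  have "x \<in> {g 0, g 1}"
    if g': "arc g'" "path_image g' = path_image g" "x = g' 0 \<or> x = g' 1" for x g'
    using g'(3)
  proof
    assume "x = g' 0"
    then show ?thesis
      using arc_start_in_ends[OF assms g'(1)] g'(2) by simp
  next
    assume "x = g' 1"
    then show ?thesis
      using arc_start_in_ends[OF assms arc_reversepath[OF g'(1)]] g'(2)
      by (simp add: path_image_reversepath) (simp add: reversepath_def)
  qed
  then show ?thesis
    using assms unfolding arc_endpoints_def pathstart_def pathfinish_def by blast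
qed

lemma is_arc_obtain_endpoints:
  fixes A :: "'a::t2_space set"
  assumes "is_arc A"
  obtains a b where "arc_endpoints A = {a, b}" "a \<noteq> b"
proof -
  obtain g where g: "arc g" "path_image g = A"
    using assms is_arc_iff_path_image by blast
  then have "g 0 \<noteq> g 1"
    using arc_distinct_ends[OF g(1)] by (simp add: pathstart_def pathfinish_def)
  then show ?thesis
    using that arc_endpoints_path_image[OF g(1)] g(2) by blast
qed

lemma is_arc_obtain_path:
  fixes A :: "'a::t2_space set"
  assumes "is_arc A" "arc_endpoints A = {a, b}" "a \<noteq> b"
  obtains g where "arc g" "path_image g = A" "g 0 = a" "g 1 = b"
proof -
  obtain g where g: "arc g" "path_image g = A"
    using assms is_arc_iff_path_image by blast
  have "{g 0, g 1} = {a, b}"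
    using arc_endpoints_path_image[OF g(1)] g(2) assms(2) by simp
  then consider "g 0 = a" "g 1 = b" | "g 0 = b" "g 1 = a"
    using assms(3) by (auto simp: doubleton_eq_iff)
  then show ?thesis
  proof cases
    case 1
    with g that show ?thesis by blast
  next
    case 2
    with g that[of "reversepath g"] show ?thesis
      by (simp add: arc_reversepath path_image_reversepath) (simp add: reversepath_def)
  qed
qed

lemma arc_compose_homeomorphism:
  assumes "arc g" "homeomorphism (path_image g) B h k"
  shows "arc (h \<circ> g)" "path_image (h \<circ> g) = B"
proof -
  have "inj_on h (path_image g)" "continuous_on (path_image g) h" "h ` path_image g = B"
    using assms(2) by (auto simp: homeomorphism_def intro: inj_on_inverseI)
  then show "arc (h \<circ> g)" "path_image (h \<circ> g) = B"
    using assms(1) continuous_on_compose[of "{0..1}" g h]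
    by (auto simp: arc_def path_def path_image_def intro!: comp_inj_on)
qed

lemma arc_endpoints_homeomorphism:
  fixes A :: "'a::t2_space set" and B :: "'b::t2_space set"
  assumes "is_arc A" "homeomorphism A B h k"
  shows "arc_endpoints B = h ` arc_endpoints A"
proof -
  obtain g where g: "arc g" "path_image g = A"
    using assms is_arc_iff_path_image by blast
  then have "arc (h \<circ> g)" "path_image (h \<circ> g) = B"
    using arc_compose_homeomorphism assms(2) by blast+
  then show ?thesis
    using arc_endpoints_path_image[of "h \<circ> g"] arc_endpoints_path_image[OF g(1)] g(2) by simp
qed

text \<open>If \<open>g\<close> parametrizes \<open>A\<close>, then \<open>h \<circ> g\<close>
  parametrizes \<open>B\<close>, and both subarcs are images of the same parameter interval;
  symmetry of \<open>subarc\<close> covers the other order of the parameters.\<close>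

lemma subarc_homeomorphism:
  fixes A :: "'a::t2_space set" and B :: "'b::t2_space set"
  assumes "is_arc A" "homeomorphism A B h k" "x \<in> A" "y \<in> A"
  shows "subarc B (h x) (h y) = h ` subarc A x y"
proof -
  obtain g where g: "arc g" "path_image g = A"
    using assms is_arc_iff_path_image by blast
  then have hg: "arc (h \<circ> g)" "path_image (h \<circ> g) = B"
    using arc_compose_homeomorphism assms(2) by blast+
  have *: "subarc B (h (g s)) (h (g t)) = h ` subarc A (g s) (g t)" if "0 \<le> s" "s \<le> t" "t \<le> 1" for s t
    using subarc_path_image[OF hg(1) that] subarc_path_image[OF g(1) that] hg(2) g(2)
    by (simp add: image_comp)
  obtain s t where st: "x = g s" "y = g t" "0 \<le> s" "s \<le> 1" "0 \<le> t" "t \<le> 1"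
    using assms(3,4) g(2) by (auto simp: path_image_def)
  then show ?thesis
    using *[of s t] *[of t s] subarc_commute by (metis linear)
qed

text \<open>By uniform continuity of \<open>g\<close>, close parameters give initial segments at
  small Hausdorff distance. The choice \<open>e/3\<close> keeps the bound strict after the factor 2
  of \<open>whitney_Lipschitz\<close>.\<close>

lemma continuous_on_whitney_image:
  fixes g :: "real \<Rightarrow> 'a::{metric_space, second_countable_topology}"
  assumes "continuous_on {0..1} g"
  shows "continuous_on {0..1} (\<lambda>t. whitney (g ` {0..t}))"
  unfolding continuous_on_iff
proof (intro ballI allI impI)
  fix t e :: real
  assume t: "t \<in> {0..1}" and e: "0 < e"
  have "uniformly_continuous_on {0..1} g"
    using assms compact_uniformly_continuous by blast
  then obtain d where d: "0 < d"
      "\<And>u v. u \<in> {0..1} \<Longrightarrow> v \<in> {0..1} \<Longrightarrow> dist u v < d \<Longrightarrow> dist (g u) (g v) < e/3"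
    unfolding uniformly_continuous_on_def using e by (metis zero_less_divide_iff zero_less_numeral)
  have near: "\<exists>y\<in>g ` {0..v}. dist x y \<le> e/3"
    if uv: "u \<in> {0..1}" "v \<in> {0..1}" "dist u v < d" "x \<in> g ` {0..u}" for u v x
  proof -
    obtain r where r: "x = g r" "0 \<le> r" "r \<le> u"
      using uv by auto
    \<comment> \<open>A parameter beyond \<open>v\<close> is clipped to \<open>v\<close>, which
      moves it by less than \<open>d\<close>.\<close>
    then have "dist (g r) (g (min r v)) < e/3"
      using uv by (intro d) (auto simp: dist_real_def min_def)
    moreover have "g (min r v) \<in> g ` {0..v}"
      using r uv by auto
    ultimately show ?thesis
      using r less_imp_le by blast
  qed
  show "\<exists>d>0. \<forall>s\<in>{0..1}. dist s t < d \<longrightarrow> dist (whitney (g ` {0..s})) (whitney (g ` {0..t})) < e"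
  proof (intro exI[of _ d] conjI ballI impI)
    fix s :: real
    assume s: "s \<in> {0..1}" "dist s t < d"
    have "\<bar>whitney (g ` {0..s}) - whitney (g ` {0..t})\<bar> \<le> 2 * (e/3)"
      using near[OF s(1) t s(2)] near[OF t s(1)] s t by (intro whitney_Lipschitz) (auto simp: dist_commute)
    then show "dist (whitney (g ` {0..s})) (whitney (g ` {0..t})) < e"
      using e by (simp add: dist_real_def)
  qed (use d in auto)
qed

lemma continuous_on_whitney_subarc:
  fixes A :: "'a::{metric_space, second_countable_topology} set"
  assumes "is_arc A" "arc_endpoints A = {a, b}" "a \<noteq> b"
  shows "continuous_on A (\<lambda>x. whitney (subarc A a x))"
proof -
  obtain g where g: "arc g" "path_image g = A" "g 0 = a" "g 1 = b"
    using is_arc_obtain_path[OF assms] .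
  obtain k where k: "homeomorphism {0..1} A g k"
    using homeomorphism_arc[OF g(1)] g(2) by auto
  have "continuous_on A (\<lambda>x. whitney (g ` {0..k x}))"
    using k continuous_on_whitney_image[of g] unfolding homeomorphism_def
    by (intro continuous_on_compose2[of "{0..1}" "\<lambda>t. whitney (g ` {0..t})" A k]) auto
  moreover have "subarc A a x = g ` {0..k x}" if "x \<in> A" for x
  proof -
    have "k x \<in> {0..1}" "g (k x) = x"
      using k that by (auto simp: homeomorphism_def)
    then show ?thesis
      using subarc_path_image[OF g(1), of 0 "k x"] g by simp
  qed
  ultimately show ?thesis
    by (simp cong: continuous_on_cong)
qed

subsection \<open>Position of a point along an arc\<close>

text \<open>Sizes need not add up along an arc, so the size measured from \<open>a\<close> alone
  would not determine the one measured from \<open>b\<close>. The difference treats both ends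
  alike.\<close>

definition whitney_gap :: "'a::{metric_space, second_countable_topology} set \<Rightarrow> 'a \<Rightarrow> 'a \<Rightarrow> 'a \<Rightarrow> real" where
  "whitney_gap A a b x = whitney (subarc A a x) - whitney (subarc A b x)"

text \<open>Exchanging the ends negates the gap. This is what makes the extension independent of the
  orientation of the arcs.\<close>

definition position :: "'a::{metric_space, second_countable_topology} set \<Rightarrow> 'a \<Rightarrow> 'a \<Rightarrow> 'a \<Rightarrow> real" where
  "position A a b x = (whitney_gap A a b x - whitney_gap A a b a) / (whitney_gap A a b b - whitney_gap A a b a)"

text \<open>As the point moves from \<open>a\<close> towards \<open>b\<close>, the subarc from
  \<open>a\<close> grows strictly and the subarc from \<open>b\<close> shrinks strictly, so both
  parts push the difference up.\<close>

lemma whitney_gap_strict_mono: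
  assumes "arc g" "path_image g = A" "g 0 = a" "g 1 = b" "0 \<le> s" "s < t" "t \<le> 1"
  shows "whitney_gap A a b (g s) < whitney_gap A a b (g t)"
proof -
  have inj: "inj_on g {0..1}" and cont: "continuous_on {0..1} g"
    using assms(1) by (auto simp: arc_def path_def)
  have sub: "whitney (g ` {p..q}) < whitney (g ` {p'..q'})"
    if "p' \<le> p" "p \<le> q" "q \<le> q'" "0 \<le> p'" "q' \<le> 1" "p' < p \<or> q < q'" for p q p' q'
  proof (rule whitney_strict_mono)
    have "compact (g ` {p..q})"
      using that by (intro compact_continuous_image continuous_on_subset[OF cont]) auto
    then show "closed (g ` {p..q})"
      by (rule compact_imp_closed)
    have "g ` {p..q} \<noteq> g ` {p'..q'}"
      using inj_on_image_eq_iff[OF inj, of "{p..q}" "{p'..q'}"] that by auto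
    then show "g ` {p..q} \<subset> g ` {p'..q'}"
      using that by (auto simp: psubset_eq)
  qed (use that in auto)
  have "subarc A a (g r) = g ` {0..r}" "subarc A b (g r) = g ` {r..1}" if "r \<in> {0..1}" for r
    using subarc_path_image[OF assms(1), of 0 r] subarc_path_image[OF assms(1), of r 1] that assms
    by (auto simp: subarc_commute)
  moreover have "whitney (g ` {0..s}) < whitney (g ` {0..t})" "whitney (g ` {t..1}) < whitney (g ` {s..1})"
    using assms by (intro sub; simp)+
  ultimately show ?thesis
    using assms by (simp add: whitney_gap_def)
qed

context
  fixes A :: "'a::{metric_space, second_countable_topology} set" and a b :: 'a
  assumes arc: "is_arc A" and ends: "arc_endpoints A = {a, b}" and ne: "a \<noteq> b"
begin

lemma endpoints_in_arc: "a \<in> A" "b \<in> A"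
  using is_arc_obtain_path[OF arc ends ne] by (force simp: path_image_def)+

lemma whitney_gap_less: "whitney_gap A a b a < whitney_gap A a b b"
proof -
  obtain g where g: "arc g" "path_image g = A" "g 0 = a" "g 1 = b"
    using is_arc_obtain_path[OF arc ends ne] .
  then show ?thesis
    using whitney_gap_strict_mono[of g A a b 0 1] by simp
qed

lemma position_start [simp]: "position A a b a = 0"
  by (simp add: position_def)

lemma position_end [simp]: "position A a b b = 1"
  using whitney_gap_less by (simp add: position_def)

lemma position_swap: "position A b a x = 1 - position A a b x"
proof -
  have "whitney_gap A b a y = - whitney_gap A a b y" for y
    by (simp add: whitney_gap_def)
  then show ?thesis
    using whitney_gap_less by (simp add: position_def divide_simps)
qed

lemma continuous_on_whitney_gap: "continuous_on A (whitney_gap A a b)"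
  using continuous_on_whitney_subarc[OF arc ends ne] continuous_on_whitney_subarc[of A b a] arc ends ne
  unfolding whitney_gap_def by (intro continuous_intros) (auto simp: insert_commute)

lemma continuous_on_position: "continuous_on A (position A a b)"
  using continuous_on_whitney_gap whitney_gap_less unfolding position_def by (intro continuous_intros) auto

lemma inj_on_position: "inj_on (position A a b) A"
proof (rule inj_onI)
  fix x y
  assume xy: "x \<in> A" "y \<in> A" "position A a b x = position A a b y"
  obtain g where g: "arc g" "path_image g = A" "g 0 = a" "g 1 = b"
    using is_arc_obtain_path[OF arc ends ne] .
  obtain s t where st: "x = g s" "y = g t" "0 \<le> s" "s \<le> 1" "0 \<le> t" "t \<le> 1"
    using xy g(2) by (auto simp: path_image_def)
  have "whitney_gap A a b x = whitney_gap A a b y"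
    using xy(3) whitney_gap_less by (simp add: position_def)
  then have "s = t"
    using whitney_gap_strict_mono[OF g, of s t] whitney_gap_strict_mono[OF g, of t s] st
    by (cases s t rule: linorder_cases) auto
  then show "x = y"
    using st by simp
qed

text \<open>Monotonicity of the gap confines positions to the unit interval; the image is connected
  and contains 0 and 1, so it is all of it.\<close>

lemma position_image: "position A a b ` A = {0..1}"
proof -
  obtain g where g: "arc g" "path_image g = A" "g 0 = a" "g 1 = b"
    using is_arc_obtain_path[OF arc ends ne] .
  have "position A a b x \<in> {0..1}" if x: "x \<in> A" for x
  proof -
    obtain s where s: "x = g s" "0 \<le> s" "s \<le> 1"
      using x g(2) by (auto simp: path_image_def)
    have "whitney_gap A a b a \<le> whitney_gap A a b x"
      using whitney_gap_strict_mono[OF g, of 0 s] g s by (cases "s = 0") auto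
    moreover have "whitney_gap A a b x \<le> whitney_gap A a b b"
      using whitney_gap_strict_mono[OF g, of s 1] g s by (cases "s = 1") auto
    ultimately show ?thesis
      using whitney_gap_less by (simp add: position_def)
  qed
  moreover have "connected (position A a b ` A)"
    using continuous_on_position connected_arc_image[OF g(1)] g(2) by (intro connected_continuous_image) auto
  moreover have "0 \<in> position A a b ` A" "1 \<in> position A a b ` A"
    using position_start position_end endpoints_in_arc by (metis imageI)+
  ultimately show ?thesis
    using connected_contains_Icc[of "position A a b ` A" 0 1] by blast
qed

end

section \<open>Metric preliminaries on arcs and limits\<close>

lemma is_arc_compact_connected:
  fixes A :: "'a::t2_space set"
  assumes "is_arc A"
  shows "compact A" "connected A"
proof -
  obtain g where "arc g" "path_image g = A"
    using assms is_arc_iff_path_image by blast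
  then show "compact A" "connected A"
    using compact_arc_image[of g] connected_arc_image[of g] by simp_all
qed

lemma subarc_subset:
  fixes A :: "'a::t2_space set"
  assumes "is_arc A" "x \<in> A" "y \<in> A"
  shows "subarc A x y \<subseteq> A"
proof -
  have "connected A"
    using is_arc_compact_connected(2)[OF assms(1)] .
  then show ?thesis
    using assms(2,3) by (auto simp: subarc_def)
qed

lemma tendsto_dist_0_transform:
  fixes u v :: "nat \<Rightarrow> 'a::metric_space"
  assumes "u \<longlonglongrightarrow> x" "(\<lambda>j. dist (u j) (v j)) \<longlonglongrightarrow> 0"
  shows "v \<longlonglongrightarrow> x"
proof (rule tendsto_dist_iff[THEN iffD2])
  have lim: "(\<lambda>j. dist (u j) (v j) + dist (u j) x) \<longlonglongrightarrow> 0"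
    using tendsto_add[OF assms(2) tendsto_dist_iff[THEN iffD1, OF assms(1)]] by simp
  have "dist (v j) x \<le> dist (u j) (v j) + dist (u j) x" for j
    using dist_triangle3[of "v j" x "u j"] .
  then show "(\<lambda>j. dist (v j) x) \<longlonglongrightarrow> 0"
    by (intro tendsto_sandwich[OF _ _ tendsto_const lim]) auto
qed

text \<open>A supremum of reals is an upper bound only for a set bounded above; compactness and
  continuity provide that bound.\<close>

lemma dist_le_sup_dist:
  fixes h :: "'a::metric_space \<Rightarrow> 'a"
  assumes "compact S" "continuous_on S h" "x \<in> S"
  shows "dist (h x) x \<le> sup_dist S h id"
proof -
  have "continuous_on S (\<lambda>p. dist (h p) (id p))"
    unfolding id_def using assms(2) by (intro continuous_on_dist continuous_on_id)
  then have "bdd_above ((\<lambda>p. dist (h p) (id p)) ` S)"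
    using assms(1) by (intro bounded_imp_bdd_above compact_imp_bounded compact_continuous_image)
  from cSUP_upper[OF assms(3) this] show ?thesis
    by (simp add: sup_dist_def)
qed

subsection \<open>Converging arcs\<close>

text \<open>The data supplied by condition (3b), with the subsequence already absorbed into
  \<open>A\<close>, so that one can pass to further subsequences.\<close>

locale converging_arcs =
  fixes A\<^sub>0 :: "'a::{metric_space, second_countable_topology} set"
    and A :: "nat \<Rightarrow> 'a set" and h :: "nat \<Rightarrow> 'a \<Rightarrow> 'a"
  assumes arc: "is_arc A\<^sub>0"
    and homeo: "\<exists>k. homeomorphism A\<^sub>0 (A j) (h j) k"
    and sup_dist: "(\<lambda>j. sup_dist A\<^sub>0 (h j) id) \<longlonglongrightarrow> 0"
begin

lemma dist_le: "x \<in> A\<^sub>0 \<Longrightarrow> dist (h j x) x \<le> sup_dist A\<^sub>0 (h j) id"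
  using homeo[of j] by (intro dist_le_sup_dist is_arc_compact_connected(1) arc) (auto simp: homeomorphism_def)

lemma dist_tendsto_0:
  assumes "\<And>j. z j \<in> A\<^sub>0"
  shows "(\<lambda>j. dist (h j (z j)) (z j)) \<longlonglongrightarrow> 0"
  by (rule tendsto_sandwich[OF _ _ tendsto_const sup_dist]) (auto simp: dist_le assms)

lemma tendsto_image:
  assumes "\<And>j. z j \<in> A\<^sub>0" "z \<longlonglongrightarrow> x"
  shows "(\<lambda>j. h j (z j)) \<longlonglongrightarrow> x"
  using tendsto_dist_0_transform[OF assms(2)] dist_tendsto_0[OF assms(1)] by (simp add: dist_commute)

text \<open>Pulls points of the converging arcs back to the limit arc without changing their limit,
  which shows that the limit lies on that arc.\<close>

lemma tendsto_preimage:
  assumes "\<And>j. z j \<in> A\<^sub>0" "(\<lambda>j. h j (z j)) \<longlonglongrightarrow> x"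
  shows "z \<longlonglongrightarrow> x"
  using tendsto_dist_0_transform[OF assms(2)] dist_tendsto_0[OF assms(1)] by simp

lemma arc_endpoints_seq: "arc_endpoints (A j) = h j ` arc_endpoints A\<^sub>0"
  using arc_endpoints_homeomorphism[OF arc] homeo[of j] by blast

lemma inj: "inj_on (h j) A\<^sub>0"
  using homeo[of j] by (auto simp: homeomorphism_def intro: inj_on_inverseI)

lemma image: "h j ` A\<^sub>0 = A j"
  using homeo[of j] by (auto simp: homeomorphism_def)

lemma subseq:
  assumes "strict_mono r"
  shows "converging_arcs A\<^sub>0 (A \<circ> r) (h \<circ> r)"
  using arc homeo LIMSEQ_subseq_LIMSEQ[OF sup_dist assms]
  by unfold_locales (auto simp: o_def)

text \<open>The subarc of \<open>A j\<close> is the image under \<open>h j\<close> of a subarc of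
  \<open>A\<^sub>0\<close>, hence at Hausdorff distance at most the sup distance of
  \<open>h j\<close> from the identity. The sizes therefore differ by a null sequence from sizes on
  the fixed arc, where continuity applies.\<close>

lemma whitney_subarc_tendsto:
  assumes ends: "arc_endpoints A\<^sub>0 = {a, b}" "a \<noteq> b"
    and z: "\<And>j. z j \<in> A\<^sub>0" "z \<longlonglongrightarrow> x" "x \<in> A\<^sub>0"
  shows "(\<lambda>j. whitney (subarc (A j) (h j a) (h j (z j)))) \<longlonglongrightarrow> whitney (subarc A\<^sub>0 a x)"
proof (rule tendsto_dist_0_transform)
  show "(\<lambda>j. whitney (subarc A\<^sub>0 a (z j))) \<longlonglongrightarrow> whitney (subarc A\<^sub>0 a x)"
    using continuous_on_whitney_subarc[OF arc ends] z unfolding continuous_on_sequentially o_def by blast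
  have a: "a \<in> A\<^sub>0"
    using endpoints_in_arc[OF arc ends] by simp
  have le: "\<bar>whitney (subarc A\<^sub>0 a (z j)) - whitney (subarc (A j) (h j a) (h j (z j)))\<bar>
      \<le> 2 * sup_dist A\<^sub>0 (h j) id" for j
  proof -
    let ?K = "subarc A\<^sub>0 a (z j)"
    have eq: "subarc (A j) (h j a) (h j (z j)) = h j ` ?K"
      using subarc_homeomorphism[OF arc _ a z(1)] homeo[of j] by blast
    have "a \<in> ?K" "?K \<subseteq> A\<^sub>0"
      using subarc_subset[OF arc a z(1)] by (auto simp: subarc_def)
    then have "dist (h j x) x \<le> sup_dist A\<^sub>0 (h j) id" "dist x (h j x) \<le> sup_dist A\<^sub>0 (h j) id" if "x \<in> ?K" for x
      using dist_le[of x j] that by (auto simp: dist_commute)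
    then show ?thesis
      unfolding eq using \<open>a \<in> ?K\<close> by (intro whitney_Lipschitz) blast+
  qed
  have "(\<lambda>j. 2 * sup_dist A\<^sub>0 (h j) id) \<longlonglongrightarrow> 2 * 0"
    by (intro tendsto_intros sup_dist)
  then have lim: "(\<lambda>j. 2 * sup_dist A\<^sub>0 (h j) id) \<longlonglongrightarrow> 0"
    by simp
  show "(\<lambda>j. dist (whitney (subarc A\<^sub>0 a (z j))) (whitney (subarc (A j) (h j a) (h j (z j))))) \<longlonglongrightarrow> 0"
    by (rule tendsto_sandwich[OF _ _ tendsto_const lim]) (auto simp: le dist_real_def)
qed

lemma position_tendsto:
  assumes ends: "arc_endpoints A\<^sub>0 = {a, b}" "a \<noteq> b"
    and z: "\<And>j. z j \<in> A\<^sub>0" "z \<longlonglongrightarrow> x" "x \<in> A\<^sub>0"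
  shows "(\<lambda>j. position (A j) (h j a) (h j b) (h j (z j))) \<longlonglongrightarrow> position A\<^sub>0 a b x"
proof -
  have ends': "arc_endpoints A\<^sub>0 = {b, a}" "b \<noteq> a"
    using ends by auto
  \<comment> \<open>A position is built from gaps at three points, so this is used for
    \<open>z\<close> and for the constant sequences \<open>a\<close> and \<open>b\<close>. The limit
    of the denominators is nonzero by \<open>whitney_gap_less\<close>.\<close>
  have "(\<lambda>j. whitney_gap (A j) (h j a) (h j b) (h j (w j))) \<longlonglongrightarrow> whitney_gap A\<^sub>0 a b y"
    if w: "\<And>j. w j \<in> A\<^sub>0" "w \<longlonglongrightarrow> y" "y \<in> A\<^sub>0" for w y
    unfolding whitney_gap_def
    using whitney_subarc_tendsto[OF ends w] whitney_subarc_tendsto[OF ends' w] by (rule tendsto_diff)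
  then show ?thesis
    using z endpoints_in_arc[OF arc ends] whitney_gap_less[OF arc ends]
    unfolding position_def by (intro tendsto_intros) auto
qed

end

subsection \<open>Laminations\<close>

lemma lamination_is_arc: "lamination X L \<Longrightarrow> A \<in> L \<Longrightarrow> is_arc A"
  by (rule bspec[OF conjunct1[OF iffD1[OF lamination_def]]])

lemma lamination_Union: "lamination X L \<Longrightarrow> X = \<Union>L"
  unfolding lamination_def by (elim conjE)

lemma lamination_obtain_endpoints:
  fixes L :: "'a::metric_space set set"
  assumes "lamination X L" "A \<in> L"
  obtains a b where "arc_endpoints A = {a, b}" "a \<noteq> b"
  by (rule is_arc_obtain_endpoints[OF lamination_is_arc[OF assms]]) (rule that)

lemma endpoint_setI: "A \<in> L \<Longrightarrow> a \<in> arc_endpoints A \<Longrightarrow> a \<in> endpoint_set L"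
  by (auto simp: endpoint_set_def)

lemma lamination_inter:
  assumes "lamination X L" "A \<in> L" "B \<in> L" "A \<noteq> B" "x \<in> A" "x \<in> B"
  shows "x \<in> arc_endpoints A" "x \<in> arc_endpoints B" "A \<inter> B = {x}"
proof -
  have "A \<inter> B \<noteq> {}"
    using assms(5,6) by blast
  moreover have "A \<inter> B = {} \<or> (\<exists>p \<in> arc_endpoints A \<inter> arc_endpoints B. A \<inter> B = {p})"
    by (rule assms(1)[unfolded lamination_def, THEN conjunct2, THEN conjunct2, THEN conjunct1,
        THEN bspec, OF assms(2), THEN bspec, OF assms(3), THEN mp, OF assms(4)])
  ultimately obtain p where p: "p \<in> arc_endpoints A" "p \<in> arc_endpoints B" "A \<inter> B = {p}"
    by blast
  then have "x = p"
    using assms(5,6) by blast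
  with p show "x \<in> arc_endpoints A" "x \<in> arc_endpoints B" "A \<inter> B = {x}"
    by simp_all
qed

text \<open>In particular an arc of a lamination is determined by its two ends, so image arcs found
  separately can be identified.\<close>

lemma lamination_arc_unique:
  assumes L: "lamination X L" "A \<in> L" "B \<in> L" and "x \<in> A \<inter> B" "y \<in> A \<inter> B" "x \<noteq> y"
  shows "A = B"
proof (rule ccontr)
  assume "A \<noteq> B"
  then have "A \<inter> B = {x}"
    using lamination_inter(3)[OF L] assms(4) by blast
  with assms(5,6) show False
    by simp
qed

lemma lamination_accumulation:
  fixes L :: "'a::metric_space set set"
  assumes "lamination X L" "range A \<subseteq> L" "(\<lambda>i. diameter (A i)) \<longlonglongrightarrow> 0"
    and "accumulation_point A p" "p \<in> X"
  shows "p \<in> endpoint_set L"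
proof -
  note assms(1)[unfolded lamination_def, THEN conjunct2, THEN conjunct2, THEN conjunct2, THEN spec, THEN mp, OF assms(2)]
  then show ?thesis
    using assms(3-5) by (simp only: if_True) blast
qed

lemma lamination_obtain_limit:
  fixes L :: "'a::{metric_space, second_countable_topology} set set"
  assumes "lamination X L" "range A \<subseteq> L" "\<not> (\<lambda>i. diameter (A i)) \<longlonglongrightarrow> 0"
  obtains A\<^sub>0 r h where "A\<^sub>0 \<in> L" "strict_mono r" "converging_arcs A\<^sub>0 (A \<circ> r) h"
proof -
  note assms(1)[unfolded lamination_def, THEN conjunct2, THEN conjunct2, THEN conjunct2, THEN spec, THEN mp, OF assms(2)]
  then obtain A\<^sub>0 r h where *: "A\<^sub>0 \<in> L" "strict_mono r" "\<forall>j. \<exists>k. homeomorphism A\<^sub>0 (A (r j)) (h j) k"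
      "(\<lambda>j. sup_dist A\<^sub>0 (h j) id) \<longlonglongrightarrow> 0"
    using assms(3) by (simp only: if_False) blast
  have "converging_arcs A\<^sub>0 (A \<circ> r) h"
    using * lamination_is_arc[OF assms(1)] by unfold_locales auto
  with *(1,2) show ?thesis
    by (rule that)
qed

lemma shrinking_arcs_tendsto:
  fixes A :: "nat \<Rightarrow> 'a::metric_space set"
  assumes "(\<lambda>i. diameter (A i)) \<longlonglongrightarrow> 0" "\<And>i. is_arc (A i)"
    and "\<And>i. u i \<in> A i" "\<And>i. v i \<in> A i" "u \<longlonglongrightarrow> x"
  shows "v \<longlonglongrightarrow> x"
proof (rule tendsto_dist_0_transform[OF assms(5)])
  show "(\<lambda>i. dist (u i) (v i)) \<longlonglongrightarrow> 0"
    by (rule tendsto_sandwich[OF _ _ tendsto_const assms(1)])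
      (auto intro!: always_eventually diameter_bounded_bound compact_imp_bounded is_arc_compact_connected(1) assms)
qed

lemma accumulation_pointI:
  assumes "x \<longlonglongrightarrow> p" "\<And>i. x i \<in> A i"
  shows "accumulation_point A p"
  unfolding accumulation_point_def
proof (intro allI impI)
  fix U :: "'a set"
  assume U: "open U \<and> p \<in> U"
  then have "eventually (\<lambda>i. x i \<in> U) sequentially"
    using assms(1) topological_tendstoD by blast
  then obtain N where N: "\<And>i. i \<ge> N \<Longrightarrow> x i \<in> U"
    by (auto simp: eventually_sequentially)
  have "{N..} \<subseteq> {i. A i \<inter> U \<noteq> {}}"
    using N assms(2) by fastforce
  then show "infinite {i. A i \<inter> U \<noteq> {}}"
    using infinite_super[OF _ infinite_Ici] by blast
qed

text \<open>Pigeonhole on indices. It will fix the order in which the homeomorphisms onto a sequence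
  of image arcs match the ends.\<close>

lemma strict_mono_subseq_disj:
  fixes P Q :: "nat \<Rightarrow> bool"
  assumes "\<And>j. P j \<or> Q j"
  shows "\<exists>t :: nat \<Rightarrow> nat. strict_mono t \<and> ((\<forall>j. P (t j)) \<or> (\<forall>j. Q (t j)))"
proof -
  have "infinite {j. P j} \<or> infinite {j. Q j}"
  proof (rule ccontr)
    assume "\<not> ?thesis"
    then have "finite ({j. P j} \<union> {j. Q j})"
      by simp
    moreover have "{j. P j} \<union> {j. Q j} = UNIV"
      using assms by blast
    ultimately show False
      by simp
  qed
  then show ?thesis
    using infinite_enumerate[of "{j. P j}"] infinite_enumerate[of "{j. Q j}"] by auto
qed

subsection \<open>The extension\<close>

text \<open>A relation treats the two laminations symmetrically, so its converse belongs to the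
  inverse of \<open>f\<close>. Any arc through \<open>x\<close> and either order of its ends may
  serve as witness; that the choice does not matter is proved afterwards.\<close>

definition corresponds ::
  "'a::{metric_space, second_countable_topology} set set \<Rightarrow>
   'b::{metric_space, second_countable_topology} set set \<Rightarrow> ('a \<Rightarrow> 'b) \<Rightarrow> 'a \<Rightarrow> 'b \<Rightarrow> bool" where
  "corresponds LX LY f x y \<longleftrightarrow>
     (\<exists>A\<in>LX. \<exists>B\<in>LY. \<exists>a b. a \<noteq> b \<and> f a \<noteq> f b \<and> arc_endpoints A = {a, b} \<and>
        arc_endpoints B = {f a, f b} \<and> x \<in> A \<and> y \<in> B \<and> position A a b x = position B (f a) (f b) y)"

definition arcwise_extension ::
  "'a::{metric_space, second_countable_topology} set set \<Rightarrow>
   'b::{metric_space, second_countable_topology} set set \<Rightarrow> ('a \<Rightarrow> 'b) \<Rightarrow> 'a \<Rightarrow> 'b" where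
  "arcwise_extension LX LY f x = (THE y. corresponds LX LY f x y)"

text \<open>Packaged so that the theorem can instantiate it twice, for \<open>f\<close> and for its
  inverse with the laminations exchanged.\<close>

locale endpoint_map =
  fixes X :: "'a::{metric_space, second_countable_topology} set"
    and Y :: "'b::{metric_space, second_countable_topology} set"
    and LX LY f
  assumes lamX: "lamination X LX" and lamY: "lamination Y LY"
    and cont: "continuous_on (endpoint_set LX) f"
    and ends: "A \<in> LX \<Longrightarrow> \<exists>B\<in>LY. f ` arc_endpoints A = arc_endpoints B"
begin

abbreviation "F \<equiv> arcwise_extension LX LY f"

text \<open>At an end the position is 0 or 1, and \<open>f x\<close> has that same position on
  \<open>B\<close>; positions are injective.\<close>

lemma corresponds_endpoint:
  assumes "A \<in> LX" "B \<in> LY" "a \<noteq> b" "f a \<noteq> f b" "arc_endpoints A = {a, b}"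
    "arc_endpoints B = {f a, f b}" "x \<in> {a, b}" "y \<in> B" "position A a b x = position B (f a) (f b) y"
  shows "y = f x"
proof -
  have A: "is_arc A" and B: "is_arc B"
    using assms lamination_is_arc lamX lamY by blast+
  have "position B (f a) (f b) (f x) = position A a b x"
    using assms(7) position_start[OF A assms(5,3)] position_end[OF A assms(5,3)]
      position_start[OF B assms(6,4)] position_end[OF B assms(6,4)] by auto
  moreover have "f x \<in> B"
    using assms(7) endpoints_in_arc[OF B assms(6,4)] by auto
  ultimately show ?thesis
    using inj_on_position[OF B assms(6,4)] assms(8,9) by (auto dest: inj_onD)
qed

text \<open>Two different arcs through \<open>x\<close> share it as an endpoint, where both
  prescribe \<open>f x\<close>. On a single arc the image arcs share the distinct points
  \<open>f a\<close> and \<open>f b\<close>, hence coincide, and \<open>position_swap\<close> on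
  both sides reconciles the two orders of the ends.\<close>

lemma corresponds_unique:
  assumes "corresponds LX LY f x y" "corresponds LX LY f x y'"
  shows "y = y'"
proof -
  obtain A B a b where 1: "A \<in> LX" "B \<in> LY" "a \<noteq> b" "f a \<noteq> f b" "arc_endpoints A = {a, b}"
      "arc_endpoints B = {f a, f b}" "x \<in> A" "y \<in> B" "position A a b x = position B (f a) (f b) y"
    using assms(1) unfolding corresponds_def by blast
  obtain A' B' a' b' where 2: "A' \<in> LX" "B' \<in> LY" "a' \<noteq> b'" "f a' \<noteq> f b'" "arc_endpoints A' = {a', b'}"
      "arc_endpoints B' = {f a', f b'}" "x \<in> A'" "y' \<in> B'" "position A' a' b' x = position B' (f a') (f b') y'"
    using assms(2) unfolding corresponds_def by blast
  show ?thesis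
  proof (cases "A = A'")
    case False
    then have "x \<in> {a, b}" "x \<in> {a', b'}"
      using lamination_inter[OF lamX 1(1) 2(1) False 1(7) 2(7)] 1 2 by auto
    then show ?thesis
      using corresponds_endpoint[OF 1(1-6) _ 1(8,9)] corresponds_endpoint[OF 2(1-6) _ 2(8,9)] by simp
  next
    case True
    have A: "is_arc A" and B: "is_arc B" and B': "is_arc B'"
      using 1 2 lamination_is_arc lamX lamY by blast+
    have ab: "a' = a \<and> b' = b \<or> a' = b \<and> b' = a"
      using True 1(5) 2(5) by (auto simp: doubleton_eq_iff)
    have "B = B'"
      using endpoints_in_arc[OF B 1(6,4)] endpoints_in_arc[OF B' 2(6,4)] ab 1(4)
      by (intro lamination_arc_unique[OF lamY 1(2) 2(2), of "f a" "f b"]) auto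
    have "position B (f a) (f b) y' = position A a b x"
      using ab 2(9) True \<open>B = B'\<close> position_swap[OF A 1(5,3), of x] position_swap[OF B 1(6,4), of y']
      by auto
    then show ?thesis
      using inj_on_position[OF B 1(6,4)] 1(8,9) 2(8) \<open>B = B'\<close> by (auto dest: inj_onD)
  qed
qed

lemma extension_eq:
  assumes "corresponds LX LY f x y"
  shows "F x = y"
  unfolding arcwise_extension_def
proof (rule the_equality)
  show "corresponds LX LY f x y"
    by (rule assms)
next
  fix z
  assume "corresponds LX LY f x z"
  then show "z = y"
    using assms by (rule corresponds_unique)
qed

text \<open>Existence of the image point: the hypothesis on ends yields an image arc, and positions
  along it fill the whole unit interval.\<close>

lemma extension_on_arc:
  assumes "A \<in> LX" "arc_endpoints A = {a, b}" "a \<noteq> b" "x \<in> A"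
  shows "f a \<noteq> f b"
    and "\<exists>B\<in>LY. arc_endpoints B = {f a, f b} \<and> F x \<in> B \<and> position A a b x = position B (f a) (f b) (F x)"
proof -
  have A: "is_arc A"
    using assms lamination_is_arc lamX by blast
  obtain B where B: "B \<in> LY" "arc_endpoints B = {f a, f b}"
    using ends[OF assms(1)] assms(2) by auto
  \<comment> \<open>An arc has two distinct ends, so \<open>f\<close> cannot identify
    \<open>a\<close> and \<open>b\<close>.\<close>
  obtain p q where "arc_endpoints B = {p, q}" "p \<noteq> q"
    using lamination_obtain_endpoints[OF lamY B(1)] .
  with B(2) show ne: "f a \<noteq> f b"
    by auto
  have arcB: "is_arc B"
    using B lamination_is_arc lamY by blast
  have "position A a b x \<in> {0..1}"
    using position_image[OF A assms(2,3)] assms(4) by blast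
  then obtain y where y: "y \<in> B" "position A a b x = position B (f a) (f b) y"
    using position_image[OF arcB B(2) ne] by (metis imageE)
  have "corresponds LX LY f x y"
    unfolding corresponds_def
    by (intro bexI[of _ A] bexI[of _ B] exI[of _ a] exI[of _ b] conjI) (use assms B y ne in simp_all)
  then have "F x = y"
    by (rule extension_eq)
  then show "\<exists>B\<in>LY. arc_endpoints B = {f a, f b} \<and> F x \<in> B \<and> position A a b x = position B (f a) (f b) (F x)"
    using B y by blast
qed

lemma corresponds_extension:
  assumes "x \<in> X"
  shows "corresponds LX LY f x (F x)"
proof -
  obtain A where A: "A \<in> LX" "x \<in> A"
    using assms lamination_Union[OF lamX] by blast
  obtain a b where ab: "arc_endpoints A = {a, b}" "a \<noteq> b"
    using lamination_obtain_endpoints[OF lamX A(1)] .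
  obtain B where "B \<in> LY" "arc_endpoints B = {f a, f b}" "F x \<in> B"
      "position A a b x = position B (f a) (f b) (F x)"
    using extension_on_arc(2)[OF A(1) ab A(2)] by blast
  with A ab show ?thesis
    unfolding corresponds_def
    by (intro bexI[of _ A] bexI[of _ B] exI[of _ a] exI[of _ b] conjI extension_on_arc(1)[OF A(1) ab A(2)])
qed

lemma extension_endpoint:
  assumes "x \<in> endpoint_set LX"
  shows "F x = f x"
proof -
  obtain A where A: "A \<in> LX" "x \<in> arc_endpoints A"
    using assms by (auto simp: endpoint_set_def)
  obtain a b where ab: "arc_endpoints A = {a, b}" "a \<noteq> b"
    using lamination_obtain_endpoints[OF lamX A(1)] .
  have x: "x \<in> {a, b}" "x \<in> A"
    using A ab endpoints_in_arc[OF lamination_is_arc[OF lamX A(1)] ab] by auto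
  obtain B where B: "B \<in> LY" "arc_endpoints B = {f a, f b}" "F x \<in> B"
      "position A a b x = position B (f a) (f b) (F x)"
    using extension_on_arc(2)[OF A(1) ab x(2)] by blast
  then show ?thesis
    using corresponds_endpoint[OF A(1) B(1) ab(2) _ ab(1) B(2) x(1) B(3,4)] extension_on_arc(1)[OF A(1) ab x(2)]
    by blast
qed

lemma extension_inj_on_arc:
  assumes "A \<in> LX"
  shows "inj_on F A"
proof (rule inj_onI)
  fix x x'
  assume x: "x \<in> A" "x' \<in> A" "F x = F x'"
  obtain a b where ab: "arc_endpoints A = {a, b}" "a \<noteq> b"
    using lamination_obtain_endpoints[OF lamX assms] .
  obtain B where B: "B \<in> LY" "arc_endpoints B = {f a, f b}" "position A a b x = position B (f a) (f b) (F x)"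
    using extension_on_arc(2)[OF assms ab x(1)] by blast
  obtain B' where B': "B' \<in> LY" "arc_endpoints B' = {f a, f b}" "position A a b x' = position B' (f a) (f b) (F x')"
    using extension_on_arc(2)[OF assms ab x(2)] by blast
  have ne: "f a \<noteq> f b"
    using extension_on_arc(1)[OF assms ab x(1)] .
  \<comment> \<open>The image arcs were obtained separately for \<open>x\<close> and
    \<open>x'\<close>; their common ends force them to agree, so the positions become
    comparable.\<close>
  have "B = B'"
    using endpoints_in_arc[OF lamination_is_arc[OF lamY B(1)] B(2) ne]
      endpoints_in_arc[OF lamination_is_arc[OF lamY B'(1)] B'(2) ne] ne
    by (intro lamination_arc_unique[OF lamY B(1) B'(1), of "f a" "f b"]) auto
  then have "position A a b x = position A a b x'"
    using B B' x by simp
  then show "x = x'"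
    using inj_on_position[OF lamination_is_arc[OF lamX assms] ab] x by (auto dest: inj_onD)
qed

lemma extension_image: "F ` X \<subseteq> Y"
proof (rule image_subsetI)
  fix x
  assume "x \<in> X"
  then obtain B where "B \<in> LY" "F x \<in> B"
    using corresponds_extension unfolding corresponds_def by blast
  then show "F x \<in> Y"
    using lamination_Union[OF lamY] by blast
qed

section \<open>Continuity of the extension\<close>

lemma f_tendsto:
  assumes "\<And>i. u i \<in> endpoint_set LX" "x \<in> endpoint_set LX" "u \<longlonglongrightarrow> x"
  shows "(\<lambda>i. f (u i)) \<longlonglongrightarrow> f x"
  by (rule continuous_on_tendsto_compose[OF cont assms(3,2)]) (simp add: assms(1))

lemma extension_tendsto_shrinking:
  assumes A: "\<And>i. A i \<in> LX" "\<And>i. x i \<in> A i" and lim: "x \<longlonglongrightarrow> p" "p \<in> X"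
    and diam: "(\<lambda>i. diameter (A i)) \<longlonglongrightarrow> 0"
  shows "(\<lambda>i. F (x i)) \<longlonglongrightarrow> F p"
proof -
  have arcA: "is_arc (A i)" for i
    using A lamination_is_arc lamX by blast
  have "\<exists>a b. arc_endpoints (A i) = {a, b} \<and> a \<noteq> b" for i
    by (rule is_arc_obtain_endpoints[OF arcA[of i]]) blast
  then obtain a b where ab: "\<And>i. arc_endpoints (A i) = {a i, b i}" "\<And>i. a i \<noteq> b i"
    by metis
  have abA: "a i \<in> A i" "b i \<in> A i" for i
    using endpoints_in_arc[OF arcA ab] by blast+
  have abE: "a i \<in> endpoint_set LX" "b i \<in> endpoint_set LX" for i
    using endpoint_setI[OF A(1)[of i]] ab(1)[of i] by simp_all
  \<comment> \<open>Condition (3a) makes the limit an endpoint, where continuity of \<open>f\<close>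
    is available.\<close>
  have p: "p \<in> endpoint_set LX"
    using lamination_accumulation[OF lamX _ diam accumulation_pointI[OF lim(1)] lim(2)] A by blast
  have "a \<longlonglongrightarrow> p" "b \<longlonglongrightarrow> p"
    using shrinking_arcs_tendsto[OF diam arcA A(2) _ lim(1)] abA by blast+
  then have fab: "(\<lambda>i. f (a i)) \<longlonglongrightarrow> f p" "(\<lambda>i. f (b i)) \<longlonglongrightarrow> f p"
    using f_tendsto abE p by blast+
  have "\<exists>B. B \<in> LY \<and> arc_endpoints B = {f (a i), f (b i)} \<and> F (x i) \<in> B" for i
    using extension_on_arc(2)[OF A(1) ab A(2)] by blast
  then obtain B where B: "\<And>i. B i \<in> LY" "\<And>i. arc_endpoints (B i) = {f (a i), f (b i)}" "\<And>i. F (x i) \<in> B i"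
    by metis
  have ne: "f (a i) \<noteq> f (b i)" for i
    using extension_on_arc(1)[OF A(1) ab A(2)] .
  have arcB: "is_arc (B i)" for i
    using B lamination_is_arc lamY by blast
  \<comment> \<open>Otherwise (3b) would give a limit arc whose two ends are limits of ends of the
    \<open>B i\<close>, and all of these tend to \<open>f p\<close>.\<close>
  have diamB: "(\<lambda>i. diameter (B i)) \<longlonglongrightarrow> 0"
  proof (rule ccontr)
    assume *: "\<not> ?thesis"
    have "range B \<subseteq> LY"
      using B(1) by blast
    from lamination_obtain_limit[OF lamY this *]
    obtain B\<^sub>0 r h where B0: "B\<^sub>0 \<in> LY" "strict_mono r" "converging_arcs B\<^sub>0 (B \<circ> r) h" .
    interpret converging_arcs B\<^sub>0 "B \<circ> r" h
      by (rule B0(3))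
    obtain c d where cd: "arc_endpoints B\<^sub>0 = {c, d}" "c \<noteq> d"
      using is_arc_obtain_endpoints[OF arc] .
    have *: "h j e \<in> {f (a (r j)), f (b (r j))}" if "e \<in> {c, d}" for e j
      using arc_endpoints_seq[of j] B(2) cd(1) that by auto
    \<comment> \<open>Whether \<open>h j\<close> sends \<open>e\<close> to the image of
      \<open>a\<close> or of \<open>b\<close> may change with \<open>j\<close>; the sum bounds both
      cases at once.\<close>
    have le: "dist (f p) (h j e) \<le> dist (f (a (r j))) (f p) + dist (f (b (r j))) (f p)"
      if "e \<in> {c, d}" for e j
    proof -
      from * that consider "h j e = f (a (r j))" | "h j e = f (b (r j))"
        by blast
      then show ?thesis
        by cases (simp_all add: dist_commute)
    qed
    have lim: "(\<lambda>j. dist (f (a (r j))) (f p) + dist (f (b (r j))) (f p)) \<longlonglongrightarrow> 0"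
      using tendsto_add[OF fab[THEN tendsto_dist_iff[THEN iffD1], THEN LIMSEQ_subseq_LIMSEQ, OF B0(2)]]
      by (simp add: o_def)
    have dist_lim: "(\<lambda>j. dist (f p) (h j e)) \<longlonglongrightarrow> 0" if "e \<in> {c, d}" for e
      by (rule tendsto_sandwich[OF _ _ tendsto_const lim]) (simp_all add: le[OF that])
    have 1: "(\<lambda>j. h j e) \<longlonglongrightarrow> f p" if "e \<in> {c, d}" for e
      by (rule tendsto_dist_0_transform[OF tendsto_const dist_lim[OF that]])
    have 2: "(\<lambda>j. h j e) \<longlonglongrightarrow> e" if "e \<in> {c, d}" for e
      using that endpoints_in_arc[OF arc cd] by (intro tendsto_image) auto
    have "c = f p" "d = f p"
      using LIMSEQ_unique[OF 2 1] by simp_all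
    then show False
      using cd(2) by simp
  qed
  have "(\<lambda>i. F (x i)) \<longlonglongrightarrow> f p"
    by (rule shrinking_arcs_tendsto[OF diamB arcB endpoints_in_arc(1)[OF arcB B(2) ne] B(3) fab(1)])
  then show ?thesis
    using extension_endpoint[OF p] by simp
qed

text \<open>Only a subsequence is claimed, since (3b) for the image arcs, the matching of ends and
  compactness of the limit arc each require passing to one. Comparing limits of positions then
  identifies the limit of the images.\<close>

lemma extension_subseq_converging:
  assumes A0: "A\<^sub>0 \<in> LX" "converging_arcs A\<^sub>0 A h"
    and A: "\<And>i. A i \<in> LX" "\<And>i. x i \<in> A i" and lim: "x \<longlonglongrightarrow> p"
  shows "\<exists>r::nat \<Rightarrow> nat. strict_mono r \<and> (\<lambda>i. F (x (r i))) \<longlonglongrightarrow> F p"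
proof -
  interpret A: converging_arcs A\<^sub>0 A h
    by (rule A0(2))
  have "\<exists>z\<in>A\<^sub>0. h j z = x j" for j
    using A(2)[of j] unfolding A.image[of j, symmetric] by (metis imageE)
  then obtain z where z: "\<And>j. z j \<in> A\<^sub>0" "\<And>j. h j (z j) = x j"
    by metis
  have zlim: "z \<longlonglongrightarrow> p"
    using A.tendsto_preimage[OF z(1)] z(2) lim by simp
  have p: "p \<in> A\<^sub>0"
    using closed_sequentially[OF compact_imp_closed[OF is_arc_compact_connected(1)[OF A.arc]] z(1) zlim] .
  obtain a b where ab: "arc_endpoints A\<^sub>0 = {a, b}" "a \<noteq> b"
    using is_arc_obtain_endpoints[OF A.arc] .
  have abA: "a \<in> A\<^sub>0" "b \<in> A\<^sub>0"
    using endpoints_in_arc[OF A.arc ab] by blast+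
  have hab: "arc_endpoints (A j) = {h j a, h j b}" "h j a \<noteq> h j b" for j
    using A.arc_endpoints_seq[of j] ab A.inj[of j] abA by (auto simp: inj_on_def)
  have e: "(\<lambda>j. f (h j e)) \<longlonglongrightarrow> f e" if "e \<in> {a, b}" for e
  proof (rule f_tendsto)
    show "h j e \<in> endpoint_set LX" for j
      using endpoint_setI[OF A(1)[of j]] hab(1)[of j] that by auto
    show "e \<in> endpoint_set LX"
      using endpoint_setI[OF A0(1)] ab(1) that by simp
    show "(\<lambda>j. h j e) \<longlonglongrightarrow> e"
      using abA that by (intro A.tendsto_image) auto
  qed
  have fne: "f a \<noteq> f b"
    using extension_on_arc(1)[OF A0(1) ab p] .
  have "\<exists>C. C \<in> LY \<and> arc_endpoints C = {f (h j a), f (h j b)} \<and> F (x j) \<in> C \<and>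
      position (A j) (h j a) (h j b) (x j) = position C (f (h j a)) (f (h j b)) (F (x j))" for j
    using extension_on_arc(2)[OF A(1) hab A(2)] by blast
  then obtain C where C: "\<And>j. C j \<in> LY" "\<And>j. arc_endpoints (C j) = {f (h j a), f (h j b)}"
      "\<And>j. F (x j) \<in> C j"
      "\<And>j. position (A j) (h j a) (h j b) (x j) = position (C j) (f (h j a)) (f (h j b)) (F (x j))"
    by metis
  have arcC: "is_arc (C j)" for j
    using C lamination_is_arc lamY by blast
  have "f (h j a) \<noteq> f (h j b)" for j
    using extension_on_arc(1)[OF A(1) hab A(2)] .
  then have Cends: "f (h j a) \<in> C j" "f (h j b) \<in> C j" for j
    using endpoints_in_arc[OF arcC C(2)] by blast+
  \<comment> \<open>If the image arcs shrank, their two ends would have the same limit, yet these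
    ends tend to the distinct points \<open>f a\<close> and \<open>f b\<close>.\<close>
  have *: "\<not> (\<lambda>j. diameter (C j)) \<longlonglongrightarrow> 0"
  proof
    assume "(\<lambda>j. diameter (C j)) \<longlonglongrightarrow> 0"
    from shrinking_arcs_tendsto[OF this arcC Cends e[of a]] have "(\<lambda>j. f (h j b)) \<longlonglongrightarrow> f a"
      by simp
    with e[of b] fne show False
      using LIMSEQ_unique by blast
  qed
  have "range C \<subseteq> LY"
    using C(1) by blast
  from lamination_obtain_limit[OF lamY this *]
  obtain C\<^sub>0 s k where C0: "C\<^sub>0 \<in> LY" "strict_mono s" "converging_arcs C\<^sub>0 (C \<circ> s) k" .
  interpret C: converging_arcs C\<^sub>0 "C \<circ> s" k
    by (rule C0(3))
  obtain c d where cd: "arc_endpoints C\<^sub>0 = {c, d}" "c \<noteq> d"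
    using is_arc_obtain_endpoints[OF C.arc] .
  have "{k j c, k j d} = {f (h (s j) a), f (h (s j) b)}" for j
    using C.arc_endpoints_seq[of j] C(2) cd(1) by simp
  then have disj: "(k j c = f (h (s j) a) \<and> k j d = f (h (s j) b)) \<or> (k j d = f (h (s j) a) \<and> k j c = f (h (s j) b))" for j
    unfolding doubleton_eq_iff by blast
  from strict_mono_subseq_disj[of "\<lambda>j. k j c = f (h (s j) a) \<and> k j d = f (h (s j) b)"
      "\<lambda>j. k j d = f (h (s j) a) \<and> k j c = f (h (s j) b)", OF disj]
  obtain t :: "nat \<Rightarrow> nat" where t: "strict_mono t" and
    or: "(\<forall>j. k (t j) c = f (h (s (t j)) a) \<and> k (t j) d = f (h (s (t j)) b)) \<or>
      (\<forall>j. k (t j) d = f (h (s (t j)) a) \<and> k (t j) c = f (h (s (t j)) b))"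
    by blast
  \<comment> \<open>The ends of \<open>C\<^sub>0\<close> are renamed so that \<open>c\<close> always
    belongs to the \<open>a\<close> side.\<close>
  from or have "\<exists>c d. (arc_endpoints C\<^sub>0 = {c, d} \<and> c \<noteq> d) \<and>
      (\<forall>j. k (t j) c = f (h (s (t j)) a) \<and> k (t j) d = f (h (s (t j)) b))"
  proof
    assume *: "\<forall>j. k (t j) c = f (h (s (t j)) a) \<and> k (t j) d = f (h (s (t j)) b)"
    show ?thesis
      by (rule exI[of _ c], rule exI[of _ d], rule conjI[OF _ *]) (use cd in simp)
  next
    assume *: "\<forall>j. k (t j) d = f (h (s (t j)) a) \<and> k (t j) c = f (h (s (t j)) b)"
    show ?thesis
      by (rule exI[of _ d], rule exI[of _ c], rule conjI[OF _ *]) (use cd in auto)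
  qed
  then obtain c d where cd: "arc_endpoints C\<^sub>0 = {c, d}" "c \<noteq> d"
    and k: "\<And>j. k (t j) c = f (h (s (t j)) a)" "\<And>j. k (t j) d = f (h (s (t j)) b)"
    by (elim exE conjE) simp
  interpret Ct: converging_arcs C\<^sub>0 "C \<circ> s \<circ> t" "k \<circ> t"
    by (rule C.subseq[OF t])
  have st: "strict_mono (s \<circ> t)"
    by (rule strict_mono_o[OF C0(2) t])
  have cdC: "c \<in> C\<^sub>0" "d \<in> C\<^sub>0"
    using endpoints_in_arc[OF C.arc cd] by blast+
  have "(\<lambda>j. f (h (s (t j)) a)) \<longlonglongrightarrow> c" "(\<lambda>j. f (h (s (t j)) b)) \<longlonglongrightarrow> d"
    using Ct.tendsto_image[of "\<lambda>_. c" c] Ct.tendsto_image[of "\<lambda>_. d" d] cdC k by simp_all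
  moreover have "(\<lambda>j. f (h (s (t j)) a)) \<longlonglongrightarrow> f a" "(\<lambda>j. f (h (s (t j)) b)) \<longlonglongrightarrow> f b"
    using LIMSEQ_subseq_LIMSEQ[OF e st, of a] LIMSEQ_subseq_LIMSEQ[OF e st, of b] by (simp_all add: o_def)
  \<comment> \<open>The ends of the image arcs converge to the ends of \<open>C\<^sub>0\<close> and,
    by continuity of \<open>f\<close>, to \<open>f a\<close> and \<open>f b\<close>; so
    \<open>C\<^sub>0\<close> is an image arc for \<open>A\<^sub>0\<close>.\<close>
  ultimately have c: "c = f a" and d: "d = f b"
    using LIMSEQ_unique by blast+
  have "\<exists>w\<in>C\<^sub>0. k (t j) w = F (x (s (t j)))" for j
    using C(3)[of "s (t j)"] Ct.image[of j] by (metis comp_apply imageE)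
  then obtain w where w: "\<And>j. w j \<in> C\<^sub>0" "\<And>j. k (t j) (w j) = F (x (s (t j)))"
    by metis
  obtain q w\<^sub>0 where q: "w\<^sub>0 \<in> C\<^sub>0" "strict_mono q" "(w \<circ> q) \<longlonglongrightarrow> w\<^sub>0"
    using is_arc_compact_connected(1)[OF C.arc] w(1) unfolding compact_def by metis
  interpret Cq: converging_arcs C\<^sub>0 "C \<circ> s \<circ> t \<circ> q" "k \<circ> t \<circ> q"
    by (rule Ct.subseq[OF q(2)])
  \<comment> \<open>All passages to subsequences combined; the arcs \<open>A\<close> and
    \<open>C\<close> are both followed along \<open>m\<close>.\<close>
  define m where "m = s \<circ> t \<circ> q"
  have m: "strict_mono m"
    unfolding m_def by (rule strict_mono_o[OF st q(2)])
  interpret Am: converging_arcs A\<^sub>0 "A \<circ> m" "h \<circ> m"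
    by (rule A.subseq[OF m])
  have Fx: "(\<lambda>j. F (x (m j))) \<longlonglongrightarrow> w\<^sub>0"
    using Cq.tendsto_image[of "w \<circ> q" w\<^sub>0] w q by (simp add: m_def o_def)
  have "(\<lambda>j. position (A (m j)) (h (m j) a) (h (m j) b) (x (m j))) \<longlonglongrightarrow> position A\<^sub>0 a b p"
    using Am.position_tendsto[OF ab, of "z \<circ> m" p] z p LIMSEQ_subseq_LIMSEQ[OF zlim m] by simp
  moreover have "(\<lambda>j. position (C (m j)) (f (h (m j) a)) (f (h (m j) b)) (F (x (m j)))) \<longlonglongrightarrow> position C\<^sub>0 c d w\<^sub>0"
    using Cq.position_tendsto[OF cd, of "w \<circ> q" w\<^sub>0] w q k by (simp add: m_def)
  \<comment> \<open>By \<open>C(4)\<close> the two position sequences agree term by term, so their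
    limits agree.\<close>
  ultimately have pos: "position A\<^sub>0 a b p = position C\<^sub>0 (f a) (f b) w\<^sub>0"
    unfolding C(4) c d by (rule LIMSEQ_unique)
  have "corresponds LX LY f p w\<^sub>0"
    unfolding corresponds_def
    by (intro bexI[of _ A\<^sub>0] bexI[of _ C\<^sub>0] exI[of _ a] exI[of _ b] conjI)
      (use A0(1) C0(1) ab fne cd c d p q(1) pos in simp_all)
  then have "F p = w\<^sub>0"
    by (rule extension_eq)
  then show ?thesis
    using Fx m by blast
qed

lemma continuous_on_extension: "continuous_on X F"
proof (rule continuous_on_sequentiallyI)
  fix u p
  assume u: "\<forall>n. u n \<in> X" "p \<in> X" "u \<longlonglongrightarrow> p"
  \<comment> \<open>It suffices that every sequence tending to \<open>p\<close> has some subsequence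
    with images tending to \<open>F p\<close>: a sequence violating convergence would have a
    subsequence staying at distance at least \<open>e\<close>, to which this applies.\<close>
  have sub: "\<exists>r::nat \<Rightarrow> nat. strict_mono r \<and> (\<lambda>i. F (x (r i))) \<longlonglongrightarrow> F p"
    if x: "\<And>i. x i \<in> X" "x \<longlonglongrightarrow> p" for x
  proof -
    have "\<exists>A\<in>LX. x i \<in> A" for i
      using x(1) lamination_Union[OF lamX] by blast
    then obtain A where A: "\<And>i. A i \<in> LX" "\<And>i. x i \<in> A i"
      by metis
    show ?thesis
    proof (cases "(\<lambda>i. diameter (A i)) \<longlonglongrightarrow> 0")
      case True
      then show ?thesis
        using extension_tendsto_shrinking[OF A x(2) u(2)] by (intro exI[of _ id]) (simp add: strict_mono_id)
    next
      case False
      have "range A \<subseteq> LX"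
        using A(1) by blast
      from lamination_obtain_limit[OF lamX this False]
      obtain A\<^sub>0 r h where r: "A\<^sub>0 \<in> LX" "strict_mono r" "converging_arcs A\<^sub>0 (A \<circ> r) h" .
      obtain s :: "nat \<Rightarrow> nat" where s: "strict_mono s" "(\<lambda>i. F ((x \<circ> r) (s i))) \<longlonglongrightarrow> F p"
        using extension_subseq_converging[OF r(1,3), of "x \<circ> r" p] A LIMSEQ_subseq_LIMSEQ[OF x(2) r(2)]
        by auto
      then show ?thesis
        using strict_mono_o[OF r(2) s(1)] by (intro exI[of _ "r \<circ> s"]) simp
    qed
  qed
  show "(\<lambda>n. F (u n)) \<longlonglongrightarrow> F p"
  proof (rule ccontr)
    assume "\<not> ?thesis"
    then obtain e where e: "e > 0" "\<not> eventually (\<lambda>n. dist (F (u n)) (F p) < e) sequentially"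
      unfolding tendsto_iff by blast
    have "infinite {n. \<not> dist (F (u n)) (F p) < e}"
      using e(2) unfolding cofinite_eq_sequentially[symmetric] eventually_cofinite .
    then obtain r :: "nat \<Rightarrow> nat" where r: "strict_mono r" "\<And>n. \<not> dist (F (u (r n))) (F p) < e"
      using infinite_enumerate by blast
    obtain s where s: "strict_mono s" "(\<lambda>i. F ((u \<circ> r) (s i))) \<longlonglongrightarrow> F p"
      using sub[of "u \<circ> r"] u LIMSEQ_subseq_LIMSEQ[OF u(3) r(1)] by auto
    then have "eventually (\<lambda>i. dist (F (u (r (s i)))) (F p) < e) sequentially"
      using e(1) by (simp add: tendsto_iff)
    then show False
      using r(2) by simp
  qed
qed

end

text \<open>The same two arcs serve as witnesses with their roles exchanged, because
  \<open>g\<close> sends \<open>f a\<close> and \<open>f b\<close> back to \<open>a\<close> and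
  \<open>b\<close>.\<close>

lemma corresponds_inverse:
  assumes "corresponds LX LY f x y" "\<And>u. u \<in> endpoint_set LX \<Longrightarrow> g (f u) = u"
  shows "corresponds LY LX g y x"
proof -
  obtain A B a b where *: "A \<in> LX" "B \<in> LY" "a \<noteq> b" "f a \<noteq> f b" "arc_endpoints A = {a, b}"
      "arc_endpoints B = {f a, f b}" "x \<in> A" "y \<in> B" "position A a b x = position B (f a) (f b) y"
    using assms(1) unfolding corresponds_def by blast
  have "g (f a) = a" "g (f b) = b"
    using * assms(2) by (auto intro: endpoint_setI)
  then show ?thesis
    unfolding corresponds_def
    by (intro bexI[of _ B] bexI[of _ A] exI[of _ "f a"] exI[of _ "f b"] conjI) (use * in simp_all)
qed

theorem theorem16:
  fixes X Y :: "(real ^ 'n) set"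
    and LX LY :: "(real ^ 'n) set set"
    and f :: "real ^ 'n \<Rightarrow> real ^ 'n"
  assumes "CARD('n) \<ge> 2"
    and "lamination X LX" and "lamination Y LY"
    and "continuous_on (endpoint_set LX) f"
    and "f ` endpoint_set LX \<subseteq> endpoint_set LY"
    and "\<forall>A\<in>LX. \<exists>B\<in>LY. f ` arc_endpoints A = arc_endpoints B"
  shows "\<exists>F. continuous_on X F \<and> F ` X \<subseteq> Y \<and>
              (\<forall>x\<in>endpoint_set LX. F x = f x) \<and>
              (\<forall>A\<in>LX. inj_on F A) \<and>
              ((\<exists>g. homeomorphism (endpoint_set LX) (endpoint_set LY) f g \<and>
                    (\<forall>B\<in>LY. \<exists>A\<in>LX. g ` arc_endpoints B = arc_endpoints A))
                \<longrightarrow> (\<exists>G. homeomorphism X Y F G))"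
proof -
  interpret f: endpoint_map X Y LX LY f
    using assms by unfold_locales auto
  have "\<exists>G. homeomorphism X Y f.F G"
    if g: "homeomorphism (endpoint_set LX) (endpoint_set LY) f g"
      "\<forall>B\<in>LY. \<exists>A\<in>LX. g ` arc_endpoints B = arc_endpoints A" for g
  proof -
    interpret g: endpoint_map Y X LY LX g
      using assms g by unfold_locales (auto simp: homeomorphism_def)
    \<comment> \<open>The point \<open>x\<close> corresponds to \<open>f.F x\<close>, so by the
      converse relation \<open>f.F x\<close> corresponds to \<open>x\<close> under \<open>g\<close>;
      uniqueness makes \<open>x\<close> the value of \<open>g.F\<close> there.\<close>
    have "g.F (f.F x) = x" if "x \<in> X" for x
      using corresponds_inverse[OF f.corresponds_extension[OF that]] homeomorphism_apply1[OF g(1)]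
      by (intro g.extension_eq) blast
    moreover have "f.F (g.F y) = y" if "y \<in> Y" for y
      using corresponds_inverse[OF g.corresponds_extension[OF that]] homeomorphism_apply2[OF g(1)]
      by (intro f.extension_eq) blast
    ultimately have "homeomorphism X Y f.F g.F"
      using f.continuous_on_extension g.continuous_on_extension f.extension_image g.extension_image
      by (intro homeomorphismI) auto
    then show ?thesis
      by blast
  qed
  then show ?thesis
    using f.continuous_on_extension f.extension_image f.extension_endpoint f.extension_inj_on_arc
    by (intro exI[of _ f.F]) blast
qed

end
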